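(* Let $n,k\ge1$ and fix subsets $D_1,\ldots,D_k\subseteq[n-1]$. For integers $0\le i_1\le i_2\le i_3\le k$ and a permutation $\pi$ of $[k]$, let $C(i_1,i_2,i_3;\pi)$ be the number of $(\sigma_1,\ldots,\sigma_k)\in W^{(k)}$ such that, for every $i\in[k]$, $$D_i=\begin{cases}\mathrm{Des}(\sigma_{\pi(i)})&\text{if }0<i\le i_1,\\ \mathrm{Codes}(\sigma_{\pi(i)})&\text{if }i_1<i\le i_2,\\ \mathrm{Asc}(\sigma_{\pi(i)})&\text{if }i_2<i\le i_3,\\ \mathrm{Coasc}(\sigma_{\pi(i)})&\text{if }i_3<i\le k.\end{cases}$$ Then $C(i_1,i_2,i_3;\pi)$ depends only on the parity of $i_2$; in particular it does not depend on $i_1$, $i_3$ or $\pi$.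
   Context: $W=S_n$, and $W^{(k)}=\{(\sigma_1,\ldots,\sigma_k)\in W^k:\sigma_1\cdots\sigma_k=1\}$. For $\sigma\in W$: - $\mathrm{Des}(\sigma)=\{i\in[n-1]:\sigma(i)>\sigma(i+1)\}$; - $\mathrm{Codes}(\sigma)=\{i:n-i\in\mathrm{Des}(\sigma)\}$; - $\mathrm{Asc}(\sigma)=[n-1]\setminus\mathrm{Des}(\sigma)$; - $\mathrm{Coasc}(\sigma)=\{i:n-i\in\mathrm{Asc}(\sigma)\}$. *)

theory Defs
  imports "HOL-Combinatorics.Permutations"
begin

text \<open>The symmetric group \<open>S\<^sub>n\<close> is the set of all \<open>\<sigma>\<close> with \<open>\<sigma> permutes {1..n}\<close>
  under composition, and \<open>[n - 1]\<close> is \<open>{1..n - 1}\<close>.\<close>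

definition Des :: "nat \<Rightarrow> (nat \<Rightarrow> nat) \<Rightarrow> nat set" where
  "Des n \<sigma> = {i \<in> {1..n - 1}. \<sigma> i > \<sigma> (i + 1)}"

text \<open>In \<open>Codes\<close> and \<open>Coasc\<close> membership in \<open>[n - 1]\<close> is stated explicitly, so that
  the truncated subtraction \<open>n - i\<close> is a true subtraction.\<close>

definition Codes :: "nat \<Rightarrow> (nat \<Rightarrow> nat) \<Rightarrow> nat set" where
  "Codes n \<sigma> = {i \<in> {1..n - 1}. n - i \<in> Des n \<sigma>}"

definition Asc :: "nat \<Rightarrow> (nat \<Rightarrow> nat) \<Rightarrow> nat set" where
  "Asc n \<sigma> = {1..n - 1} - Des n \<sigma>"

definition Coasc :: "nat \<Rightarrow> (nat \<Rightarrow> nat) \<Rightarrow> nat set" where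
  "Coasc n \<sigma> = {i \<in> {1..n - 1}. n - i \<in> Asc n \<sigma>}"

text \<open>A \<open>k\<close>-tuple is an extensional function on \<open>{1..k}\<close> (undefined elsewhere), so that
  distinct functions are distinct tuples. The product \<open>\<sigma>\<^sub>1 \<cdots> \<sigma>\<^sub>k\<close> is
  \<open>\<sigma>\<^sub>1 \<circ> \<cdots> \<circ> \<sigma>\<^sub>k\<close>.\<close>

definition W_tuples :: "nat \<Rightarrow> nat \<Rightarrow> (nat \<Rightarrow> nat \<Rightarrow> nat) set" where
  "W_tuples n k = {\<sigma> \<in> {1..k} \<rightarrow>\<^sub>E {\<tau>. \<tau> permutes {1..n}}.
     foldr (\<circ>) (map \<sigma> [1..<k + 1]) id = id}"

definition C_count ::
  "nat \<Rightarrow> nat \<Rightarrow> (nat \<Rightarrow> nat set) \<Rightarrow> nat \<Rightarrow> nat \<Rightarrow> nat \<Rightarrow> (nat \<Rightarrow> nat) \<Rightarrow> nat" where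
  "C_count n k D i1 i2 i3 \<pi> = card {\<sigma> \<in> W_tuples n k. \<forall>i \<in> {1..k}.
     D i = (if i \<le> i1 then Des n (\<sigma> (\<pi> i))
            else if i \<le> i2 then Codes n (\<sigma> (\<pi> i))
            else if i \<le> i3 then Asc n (\<sigma> (\<pi> i))
            else Coasc n (\<sigma> (\<pi> i)))}"

end

theory Submission
  imports Defs "HOL-Library.Infinite_Set"
begin

text \<open>
  Let \<open>X\<^sub>D\<close> be the sum of all \<open>\<sigma>\<close> with descent set \<open>D\<close> in the group ring, and let \<open>w\<close> be the
  longest element of \<open>S\<^sub>n\<close>. Multiplication by \<open>w\<close> on the left, right or both sides turns \<open>Des\<close>
  into \<open>Asc\<close>, \<open>Coasc\<close> or \<open>Codes\<close>, and \<open>w = X\<^sub>F\<close> for \<open>F = [n - 1]\<close>. The count in question is thus the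
  coefficient of \<open>1\<close> in a product of all \<open>X\<close> with index \<open>D\<^sub>i\<close> and some factors \<open>X\<^sub>F\<close>, the number of
  which has the parity of \<open>k - i\<^sub>2\<close>. As \<open>w\<^sup>2 = 1\<close>, it remains to show that the coefficient of
  \<open>1\<close> in a product of elements \<open>X\<^sub>D\<close> does not depend on the order of the factors.

  By inclusion-exclusion, \<open>X\<^sub>D\<close> may be replaced by the sum of all \<open>\<sigma>\<close> with \<open>Des \<sigma> \<subseteq> S\<close>. Right
  multiplication by this sum takes an arrangement \<open>e\<close> of \<open>[n]\<close> to its stable sorts with respect to
  all words \<open>f\<close> with a content given by \<open>S\<close>. Sorting by one word after another is sorting by a
  combined key \<open>x\<close>; it fixes exactly those \<open>e\<close> for which \<open>x \<circ> e\<close> is sorted, and there are as many of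
  them as there are permutations that stabilise \<open>x\<close>, that is, all the words. So \<open>n!\<close> times the
  coefficient is the sum over all \<open>g\<close> of the product of the numbers of words fixed by \<open>g\<close>, which is
  symmetric in the factors.
\<close>

section \<open>Monotone rearrangements\<close>

abbreviation Sym :: "nat \<Rightarrow> (nat \<Rightarrow> nat) set" where
  "Sym n \<equiv> {\<sigma>. \<sigma> permutes {1..n}}"

lemma finite_Sym: "finite (Sym n)"
  by (simp add: finite_permutations)

text \<open>Both value lists on \<open>[1..<n + 1]\<close> are sorted and have the same multiset,
  and a multiset has only one sorted list. Outside \<open>{1..n}\<close> the permutation
  \<open>h\<close> is the identity.\<close>

lemma mono_on_compose_permutes_eq:
  fixes y :: "nat \<Rightarrow> nat"
  assumes "mono_on {1..n} y" and h: "h permutes {1..n}" and "mono_on {1..n} (y \<circ> h)"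
  shows "y \<circ> h = y"
proof -
  have srt: "sorted (map z [1..<n + 1])" if "mono_on {1..n} z" for z :: "nat \<Rightarrow> nat"
    unfolding sorted_map
    by (rule sorted_wrt_mono_rel[OF _ sorted_wrt_upt[of 1 "n + 1"]])
      (use that in \<open>auto intro: mono_onD\<close>)
  have "image_mset h (mset_set {1..n}) = mset_set {1..n}"
    using h by (simp add: image_mset_mset_set permutes_inj_on permutes_image)
  hence "image_mset h (mset [1..<n + 1]) = mset [1..<n + 1]"
    by (simp add: atLeastLessThanSuc_atLeastAtMost del: upt_Suc)
  hence "mset (map (y \<circ> h) [1..<n + 1]) = mset (map y [1..<n + 1])"
    by (simp del: upt_Suc mset_upt flip: multiset.map_comp)
  hence "map (y \<circ> h) [1..<n + 1] = map y [1..<n + 1]"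
    using properties_for_sort[OF _ srt[OF assms(3)]] sorted_sort_id[OF srt[OF assms(1)]] by metis
  hence "\<forall>p\<in>{1..<n + 1}. (y \<circ> h) p = y p" unfolding map_eq_conv set_upt .
  hence "(y \<circ> h) p = y p" if "p \<in> {1..n}" for p
    using that by (metis Suc_eq_plus1 atLeastLessThanSuc_atLeastAtMost)
  moreover have "(y \<circ> h) p = y p" if "p \<notin> {1..n}" for p
    using that h by (simp add: permutes_not_in)
  ultimately show ?thesis by (intro ext) blast
qed

section \<open>Stable sorting of arrangements\<close>

text \<open>An arrangement \<open>e\<close> lists the item \<open>e p\<close> at position \<open>p\<close>; \<open>f\<close> is a key on the items, and
  ties are broken by the position \<open>inv e\<close> in the old arrangement.\<close>

definition is_stable_sort :: "nat \<Rightarrow> (nat \<Rightarrow> nat) \<Rightarrow> (nat \<Rightarrow> nat) \<Rightarrow> (nat \<Rightarrow> nat) \<Rightarrow> bool" where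
  "is_stable_sort n f e e' \<longleftrightarrow> e' permutes {1..n} \<and>
     (\<forall>p\<in>{1..n}. \<forall>q\<in>{1..n}. p < q \<longrightarrow>
        f (e' p) < f (e' q) \<or> f (e' p) = f (e' q) \<and> inv e (e' p) < inv e (e' q))"

definition stable_sort :: "nat \<Rightarrow> (nat \<Rightarrow> nat) \<Rightarrow> (nat \<Rightarrow> nat) \<Rightarrow> nat \<Rightarrow> nat" where
  "stable_sort n f e = (THE e'. is_stable_sort n f e e')"

text \<open>Low digits below the base \<open>M\<close> make the order lexicographic, so a key and
  its tie-breaker merge into one numerical key.\<close>

lemma less_mult_add_iff:
  fixes a b c d M :: nat
  assumes "c < M" "d < M"
  shows "a * M + c < b * M + d \<longleftrightarrow> a < b \<or> a = b \<and> c < d"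
proof -
  have "a * M + c < b * M + d" if "a < b" "c < M" for a b c d :: nat
  proof -
    have "a * M + c < Suc a * M" using that(2) by simp
    also have "\<dots> \<le> b * M" using that by (intro mult_le_mono1) simp
    finally show ?thesis by simp
  qed
  from this[of a b c d] this[of b a d c] assms show ?thesis
    by (cases a b rule: linorder_cases) auto
qed

text \<open>Each of \<open>y \<circ> g\<close> and \<open>y \<circ> h\<close> is a sorted
  rearrangement of the other, so they agree; strictness makes \<open>y \<circ> g\<close> injective
  on \<open>{1..n}\<close>, which recovers the arrangement from its values.\<close>

lemma strict_mono_on_permutes_eq:
  fixes y :: "nat \<Rightarrow> nat"
  assumes "strict_mono_on {1..n} (y \<circ> g)" "strict_mono_on {1..n} (y \<circ> h)"
    and g: "g permutes {1..n}" and h: "h permutes {1..n}"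
  shows "g = h"
proof -
  note g' = permutes_inv[OF g]
  have "y \<circ> g \<circ> (inv g \<circ> h) = y \<circ> h"
    using g by (simp add: fun_eq_iff permutes_inverses)
  hence eq: "y \<circ> h = y \<circ> g"
    using mono_on_compose_permutes_eq[OF strict_mono_on_imp_mono_on[OF assms(1)] permutes_compose[OF h g']]
      strict_mono_on_imp_mono_on[OF assms(2)] by simp
  have "h p = g p" if "p \<in> {1..n}" for p
  proof -
    define q where "q = inv g (h p)"
    have q: "q \<in> {1..n}" "h p = g q"
      using that by (simp_all only: q_def permutes_in_image[OF g'] permutes_in_image[OF h] permutes_inverses[OF g])
    have "(y \<circ> g) p = (y \<circ> g) q" using fun_cong[OF eq, of p] q(2) by simp
    hence "p = q"
      using inj_onD[OF strict_mono_on_imp_inj_on[OF assms(1)]] that q(1) by blast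
    thus ?thesis using q by simp
  qed
  moreover have "h p = g p" if "p \<notin> {1..n}" for p
    using that by (simp only: permutes_not_in[OF g that] permutes_not_in[OF h that])
  ultimately have "h p = g p" for p by blast
  thus ?thesis by (simp add: fun_eq_iff)
qed

text \<open>On \<open>{1..n}\<close> the tie-breaker \<open>inv e\<close> is at most
  \<open>n\<close>, so it fits as a low digit in base \<open>n + 1\<close>. Existence and uniqueness
  of stable sorts thereby reduce to sorting by distinct keys.\<close>

lemma is_stable_sort_iff_strict_mono:
  assumes "e permutes {1..n}"
  shows "is_stable_sort n f e e' \<longleftrightarrow> e' permutes {1..n} \<and>
    strict_mono_on {1..n} ((\<lambda>a. f a * (n + 1) + inv e a) \<circ> e')"
proof -
  have "inv e (e' p) < n + 1" if "p \<in> {1..n}" "e' permutes {1..n}" for p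
    using that(1) permutes_in_image[OF permutes_inv[OF assms]] permutes_in_image[OF that(2)]
    by (metis Suc_eq_plus1 atLeastAtMost_iff le_imp_less_Suc)
  hence key: "f (e' p) * (n + 1) + inv e (e' p) < f (e' q) * (n + 1) + inv e (e' q) \<longleftrightarrow>
      f (e' p) < f (e' q) \<or> f (e' p) = f (e' q) \<and> inv e (e' p) < inv e (e' q)"
    if "p \<in> {1..n}" "q \<in> {1..n}" "e' permutes {1..n}" for p q
    using that by (intro less_mult_add_iff) blast+
  show ?thesis
  proof (cases "e' permutes {1..n}")
    case True
    thus ?thesis
      unfolding is_stable_sort_def strict_mono_on_def comp_apply using key by metis
  next
    case False
    thus ?thesis unfolding is_stable_sort_def by (simp only: simp_thms)
  qed
qed

lemma is_stable_sort_unique: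
  assumes "e permutes {1..n}" "is_stable_sort n f e g" "is_stable_sort n f e h"
  shows "g = h"
  using assms strict_mono_on_permutes_eq unfolding is_stable_sort_iff_strict_mono[OF assms(1)] by blast

lemma ex_strict_mono_on_permutes:
  fixes y :: "nat \<Rightarrow> nat"
  assumes inj: "inj_on y {1..n}"
  shows "\<exists>e. e permutes {1..n} \<and> strict_mono_on {1..n} (y \<circ> e)"
proof -
  obtain h where h: "bij_betw h {..<card (y ` {1..n})} (y ` {1..n})"
     "strict_mono_on {..<card (y ` {1..n})} h"
    using ex_bij_betw_strict_mono_card[of "y ` {1..n}"] by auto
  have c: "card (y ` {1..n}) = n" using card_image[OF inj] by simp
  \<comment> \<open>\<open>h\<close> enumerates the values from index 0 while positions start at 1,
    hence \<open>p - 1\<close>; off \<open>{1..n}\<close> a permutation must be the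
    identity.\<close>
  define e where "e p = (if p \<in> {1..n} then inv_into {1..n} y (h (p - 1)) else p)" for p
  have b1: "bij_betw (\<lambda>p. p - 1) {1..n} {..<n}"
    by (rule bij_betwI[of _ _ _ Suc]) auto
  have "bij_betw (inv_into {1..n} y \<circ> (h \<circ> (\<lambda>p. p - 1))) {1..n} {1..n}"
    using bij_betw_trans[OF bij_betw_trans[OF b1 h(1)[unfolded c]]
      bij_betw_inv_into[OF inj_on_imp_bij_betw[OF inj]]] .
  hence "bij_betw e {1..n} {1..n}"
    by (rule bij_betw_cong[THEN iffD1, rotated]) (simp add: e_def)
  hence "e permutes {1..n}"
    by (rule bij_imp_permutes) (auto simp: e_def)
  moreover have "y (e p) = h (p - 1)" if "p \<in> {1..n}" for p
  proof -
    have "p - 1 \<in> {..<n}" using that by auto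
    hence "h (p - 1) \<in> y ` {1..n}" using h(1) c by (metis bij_betwE)
    thus ?thesis using that by (simp add: e_def f_inv_into_f)
  qed
  moreover have "h (p - 1) < h (q - 1)" if "p \<in> {1..n}" "q \<in> {1..n}" "p < q" for p q
    using that by (intro strict_mono_onD[OF h(2)[unfolded c]]) auto
  ultimately have "e permutes {1..n}" "strict_mono_on {1..n} (y \<circ> e)"
    by (auto intro!: strict_mono_onI simp del: One_nat_def)
  thus ?thesis by blast
qed

text \<open>The low digit \<open>inv e\<close> makes the combined key injective, so a sorted
  arrangement exists; with uniqueness this justifies \<open>THE\<close>.\<close>

lemma is_stable_sort_stable_sort:
  assumes e: "e permutes {1..n}"
  shows "is_stable_sort n f e (stable_sort n f e)"
proof -
  have b: "inv e a < n + 1" if "a \<in> {1..n}" for a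
    using that permutes_in_image[OF permutes_inv[OF e]]
    by (metis Suc_eq_plus1 atLeastAtMost_iff le_imp_less_Suc)
  have "inj_on (\<lambda>a. f a * (n + 1) + inv e a) {1..n}"
  proof (rule inj_onI)
    fix p q assume pq: "p \<in> {1..n}" "q \<in> {1..n}" "f p * (n + 1) + inv e p = f q * (n + 1) + inv e q"
    hence "inv e p = inv e q"
      using less_mult_add_iff[OF b b, of p q "f p" "f q"] less_mult_add_iff[OF b b, of q p "f q" "f p"]
      by (metis less_irrefl linorder_neqE_nat)
    thus "p = q" using permutes_inj[OF permutes_inv[OF e]] by (simp add: inj_eq)
  qed
  from ex_strict_mono_on_permutes[OF this] obtain e' where e': "is_stable_sort n f e e'"
    unfolding is_stable_sort_iff_strict_mono[OF e] by blast
  show ?thesis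
    unfolding stable_sort_def
    by (rule theI[of "is_stable_sort n f e", OF e' is_stable_sort_unique[OF e _ e']])
qed

lemma stable_sort_eqI:
  assumes "e permutes {1..n}" "is_stable_sort n f e e'"
  shows "stable_sort n f e = e'"
  by (rule is_stable_sort_unique[OF assms(1) is_stable_sort_stable_sort[OF assms(1)] assms(2)])

lemma stable_sort_permutes: "e permutes {1..n} \<Longrightarrow> stable_sort n f e permutes {1..n}"
  using is_stable_sort_stable_sort[of e n f] unfolding is_stable_sort_def by blast

text \<open>For \<open>e' = e\<close> the tie-break compares the positions themselves, which are in
  order anyway; what remains is weak monotonicity of the key.\<close>

lemma stable_sort_fixed_iff:
  assumes e: "e permutes {1..n}"
  shows "stable_sort n f e = e \<longleftrightarrow> mono_on {1..n} (f \<circ> e)"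
proof -
  have "is_stable_sort n f e e \<longleftrightarrow> mono_on {1..n} (f \<circ> e)"
  proof -
    have "(p < q \<longrightarrow> f (e p) < f (e q) \<or> f (e p) = f (e q) \<and> p < q) \<longleftrightarrow>
        (p \<le> q \<longrightarrow> f (e p) \<le> f (e q))" for p q by (cases p q rule: linorder_cases) auto
    thus ?thesis
      unfolding is_stable_sort_def mono_on_def comp_apply permutes_inverses[OF e]
      by (simp only: e simp_thms) blast
  qed
  moreover have "is_stable_sort n f e e" if "stable_sort n f e = e"
    using is_stable_sort_stable_sort[OF e, of f] unfolding that .
  ultimately show ?thesis using stable_sort_eqI[OF e, of f e] by blast
qed

text \<open>The principle of radix sort: the later key \<open>f\<close> is the leading digit, ties
  in \<open>f\<close> keep the order of the first sort, and that order is by \<open>x\<close> and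
  then by \<open>e\<close>.\<close>

lemma stable_sort_stable_sort:
  assumes e: "e permutes {1..n}" and M: "\<And>a. x a < M"
  shows "stable_sort n f (stable_sort n x e) = stable_sort n (\<lambda>a. f a * M + x a) e"
proof -
  define e1 where "e1 = stable_sort n x e"
  define e2 where "e2 = stable_sort n f e1"
  have e1: "e1 permutes {1..n}" "is_stable_sort n x e e1"
    unfolding e1_def using e by (fact stable_sort_permutes is_stable_sort_stable_sort)+
  have e2: "e2 permutes {1..n}" "is_stable_sort n f e1 e2"
    unfolding e2_def using e1(1) by (fact stable_sort_permutes is_stable_sort_stable_sort)+
  have ord: "x a < x b \<or> x a = x b \<and> inv e a < inv e b"
    if "a \<in> {1..n}" "b \<in> {1..n}" "inv e1 a < inv e1 b" for a b
  proof -
    have "inv e1 a \<in> {1..n}" "inv e1 b \<in> {1..n}"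
      using that(1,2) by (simp_all only: permutes_in_image[OF permutes_inv[OF e1(1)]])
    hence "x (e1 (inv e1 a)) < x (e1 (inv e1 b)) \<or> x (e1 (inv e1 a)) = x (e1 (inv e1 b)) \<and>
        inv e (e1 (inv e1 a)) < inv e (e1 (inv e1 b))"
      using e1(2) that(3) unfolding is_stable_sort_def by blast
    thus ?thesis unfolding permutes_inverses[OF e1(1)] .
  qed
  have "is_stable_sort n (\<lambda>a. f a * M + x a) e e2"
    unfolding is_stable_sort_def
  proof (intro conjI ballI impI)
    fix p q assume pq: "p \<in> {1..n}" "q \<in> {1..n}" "p < q"
    have in': "e2 p \<in> {1..n}" "e2 q \<in> {1..n}" using pq by (simp_all only: permutes_in_image[OF e2(1)])
    have "f (e2 p) < f (e2 q) \<or> f (e2 p) = f (e2 q) \<and> inv e1 (e2 p) < inv e1 (e2 q)"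
      using e2(2) pq unfolding is_stable_sort_def by blast
    thus "f (e2 p) * M + x (e2 p) < f (e2 q) * M + x (e2 q) \<or>
       f (e2 p) * M + x (e2 p) = f (e2 q) * M + x (e2 q) \<and> inv e (e2 p) < inv e (e2 q)"
      using ord[OF in'] less_mult_add_iff[OF M M] by auto
  qed (rule e2)
  from stable_sort_eqI[OF e this] show ?thesis unfolding e2_def e1_def by (rule sym)
qed

text \<open>Fix one arrangement \<open>c\<close> that sorts \<open>x\<close>. Sorted rearrangements
  of \<open>x\<close> are all the same function, so \<open>x \<circ> e = x \<circ> c\<close> for
  every sorting \<open>e\<close>; these \<open>e\<close> are thus the stabilisers of
  \<open>x\<close> composed with \<open>c\<close>.\<close>

lemma card_mono_on_compose:
  fixes x :: "nat \<Rightarrow> nat"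
  shows "card {e \<in> Sym n. mono_on {1..n} (x \<circ> e)} = card {g \<in> Sym n. x \<circ> g = x}"
proof -
  obtain c where c: "c permutes {1..n}" "mono_on {1..n} (x \<circ> c)"
  proof -
    define c where "c = stable_sort n x id"
    have c: "is_stable_sort n x id c"
      unfolding c_def by (simp add: is_stable_sort_stable_sort permutes_id)
    hence "mono_on {1..n} (x \<circ> c)"
      unfolding is_stable_sort_def mono_on_def by (fastforce simp: le_less)
    thus ?thesis using that c is_stable_sort_def by blast
  qed
  have cc: "(e \<circ> c) \<circ> inv c = e" "(e \<circ> inv c) \<circ> c = e" for e :: "nat \<Rightarrow> nat"
    using permutes_inv_o[OF c(1)] by (simp_all only: comp_assoc comp_id)
  have 1: "g \<circ> c \<in> {e \<in> Sym n. mono_on {1..n} (x \<circ> e)}" if "g \<in> {g \<in> Sym n. x \<circ> g = x}" for g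
  proof -
    have "x \<circ> (g \<circ> c) = x \<circ> c" using that by (metis (mono_tags, lifting) comp_assoc mem_Collect_eq)
    thus ?thesis using permutes_compose[OF c(1)] c(2) that by simp
  qed
  have 2: "e \<circ> inv c \<in> {g \<in> Sym n. x \<circ> g = x}" if "e \<in> {e \<in> Sym n. mono_on {1..n} (x \<circ> e)}" for e
  proof -
    have e: "e permutes {1..n}" "mono_on {1..n} (x \<circ> e)" using that by auto
    have eq: "x \<circ> c \<circ> (inv c \<circ> e) = x \<circ> e"
      using c by (simp add: fun_eq_iff permutes_inverses)
    have "x \<circ> e = x \<circ> c"
      using mono_on_compose_permutes_eq[OF c(2) permutes_compose[OF e(1) permutes_inv[OF c(1)]]] e(2)
      unfolding eq by blast
    hence "x \<circ> (e \<circ> inv c) = (x \<circ> c) \<circ> inv c" by (simp only: comp_assoc[symmetric])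
    hence "x \<circ> (e \<circ> inv c) = x" unfolding cc .
    thus ?thesis using permutes_compose[OF permutes_inv[OF c(1)] e(1)] by simp
  qed
  have "bij_betw (\<lambda>g. g \<circ> c) {g \<in> Sym n. x \<circ> g = x} {e \<in> Sym n. mono_on {1..n} (x \<circ> e)}"
    by (intro bij_betwI[of _ _ _ "\<lambda>e. e \<circ> inv c"] Pi_I; (erule 1 | erule 2 | rule cc))
  thus ?thesis by (rule bij_betw_same_card[symmetric])
qed

section \<open>Descent sets and words\<close>

text \<open>The cut points \<open>S\<close> divide \<open>[n]\<close> into blocks, on which \<open>label S\<close> is constant.\<close>

definition label :: "nat set \<Rightarrow> nat \<Rightarrow> nat" where
  "label S p = card {d \<in> S. d < p}"

lemma label_mono: "finite S \<Longrightarrow> p \<le> q \<Longrightarrow> label S p \<le> label S q"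
  unfolding label_def by (rule card_mono) auto

lemma label_strict_mono:
  assumes "finite S" "d \<in> S" "p \<le> d" "d < q"
  shows "label S p < label S q"
proof -
  have "{d \<in> S. d < p} \<subseteq> {d \<in> S. d < q}" using assms(3,4) by auto
  moreover have "d \<in> {d \<in> S. d < q}" "d \<notin> {d \<in> S. d < p}" using assms by simp_all
  ultimately show ?thesis
    unfolding label_def using assms(1) by (intro psubset_card_mono) (simp, blast)
qed

lemma label_bounded: "finite S \<Longrightarrow> label S p < Suc (card S)"
  unfolding label_def by (simp add: card_mono le_imp_less_Suc)

text \<open>Labels of \<open>i\<close> and \<open>i + 1\<close> differ exactly when
  \<open>i \<in> S\<close>, so having descents only at cut points amounts to increasing along each
  block.\<close>

lemma Des_subset_iff:
  assumes S: "finite S" and \<sigma>: "\<sigma> permutes {1..n}"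
  shows "Des n \<sigma> \<subseteq> S \<longleftrightarrow>
    (\<forall>p\<in>{1..n}. \<forall>q\<in>{1..n}. p < q \<longrightarrow> label S p = label S q \<longrightarrow> \<sigma> p < \<sigma> q)"
proof
  assume D: "Des n \<sigma> \<subseteq> S"
  have step: "\<sigma> i < \<sigma> (Suc i)" if "i \<in> {1..n}" "Suc i \<in> {1..n}" "label S i = label S (Suc i)" for i
  proof -
    have "i \<notin> S" using label_strict_mono[OF S, of i i "Suc i"] that(3) by auto
    hence "i \<notin> Des n \<sigma>" using D by blast
    hence "\<not> \<sigma> (Suc i) < \<sigma> i" using that by (auto simp: Des_def)
    moreover have "\<sigma> i \<noteq> \<sigma> (Suc i)" using permutes_inj[OF \<sigma>] by (simp add: inj_eq)
    ultimately show ?thesis by simp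
  qed
  have "\<sigma> p < \<sigma> (Suc (p + m))"
    if "p \<in> {1..n}" "Suc (p + m) \<in> {1..n}" "label S p = label S (Suc (p + m))" for p m
    using that
  proof (induction m)
    case (Suc m)
    \<comment> \<open>Monotonicity of \<open>label S\<close> squeezes the intermediate label between
      equal ends.\<close>
    have "label S p \<le> label S (Suc (p + m))" "label S (Suc (p + m)) \<le> label S (Suc (p + Suc m))"
      by (simp_all add: label_mono[OF S])
    hence "label S p = label S (Suc (p + m))" "label S (Suc (p + m)) = label S (Suc (Suc (p + m)))"
      using Suc.prems(3) by simp_all
    thus ?case using Suc step[of "Suc (p + m)"] by simp
  qed (use step in simp)
  thus "\<forall>p\<in>{1..n}. \<forall>q\<in>{1..n}. p < q \<longrightarrow> label S p = label S q \<longrightarrow> \<sigma> p < \<sigma> q"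
    by (metis less_imp_Suc_add)
next
  assume inc: "\<forall>p\<in>{1..n}. \<forall>q\<in>{1..n}. p < q \<longrightarrow> label S p = label S q \<longrightarrow> \<sigma> p < \<sigma> q"
  show "Des n \<sigma> \<subseteq> S"
  proof
    fix i assume i: "i \<in> Des n \<sigma>"
    hence mem: "i \<in> {1..n}" "Suc i \<in> {1..n}" and desc: "\<sigma> (Suc i) < \<sigma> i" by (auto simp: Des_def)
    show "i \<in> S"
    proof (rule ccontr)
      assume "i \<notin> S"
      hence "{d \<in> S. d < i} = {d \<in> S. d < Suc i}" by (auto simp: less_Suc_eq)
      hence "label S i = label S (Suc i)" by (simp add: label_def)
      hence "\<sigma> i < \<sigma> (Suc i)" using bspec[OF bspec[OF inc mem(1)] mem(2)] by simp
      thus False using desc by simp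
    qed
  qed
qed

text \<open>All words with the content of \<open>label S\<close>: the item \<open>g p\<close>
  receives the label of position \<open>p\<close>. Being an image, the set counts a word once even
  if several \<open>g\<close> yield it.\<close>

definition words :: "nat \<Rightarrow> nat set \<Rightarrow> (nat \<Rightarrow> nat) set" where
  "words n S = (\<lambda>g. label S \<circ> inv g) ` Sym n"

lemma words_bounded: "finite S \<Longrightarrow> f \<in> words n S \<Longrightarrow> f a < Suc (card S)"
  unfolding words_def by (auto simp: label_bounded)

text \<open>The word gives each item the label of its position in \<open>e \<circ> \<sigma>\<close>.
  Labels increase weakly with that position, and inside a block the old positions
  \<open>\<sigma> p\<close> increase, as the tie-break demands.\<close>

lemma stable_sort_label:
  assumes S: "finite S" and e: "e permutes {1..n}" and \<sigma>: "\<sigma> permutes {1..n}" "Des n \<sigma> \<subseteq> S"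
  shows "stable_sort n (label S \<circ> inv (e \<circ> \<sigma>)) e = e \<circ> \<sigma>"
proof (rule stable_sort_eqI[OF e])
  have e\<sigma>: "e \<circ> \<sigma> permutes {1..n}" by (rule permutes_compose[OF \<sigma>(1) e])
  have "label S p < label S q \<or> label S p = label S q \<and> \<sigma> p < \<sigma> q"
    if "p \<in> {1..n}" "q \<in> {1..n}" "p < q" for p q
  proof (cases "label S p = label S q")
    case True
    thus ?thesis using that \<sigma>(2) Des_subset_iff[OF S \<sigma>(1)] by blast
  next
    case False
    thus ?thesis using label_mono[OF S, of p q] that(3) by simp
  qed
  moreover have "inv (e \<circ> \<sigma>) (e (\<sigma> p)) = p" for p
    using permutes_inverses(2)[OF e\<sigma>, of p] by simp
  ultimately show "is_stable_sort n (label S \<circ> inv (e \<circ> \<sigma>)) e (e \<circ> \<sigma>)"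
    unfolding is_stable_sort_def comp_apply permutes_inverses[OF e]
    using e\<sigma>[unfolded comp_def] by (simp add: comp_def)
qed

text \<open>Sorting \<open>f\<close> gives a sorted rearrangement of \<open>label S\<close>, hence
  \<open>label S\<close> itself. Ties are then exactly the blocks, and stability makes old positions
  increase along them.\<close>

lemma stable_sort_word:
  assumes S: "finite S" and e: "e permutes {1..n}" and f: "f \<in> words n S"
  shows "f = label S \<circ> inv (stable_sort n f e)" and "Des n (inv e \<circ> stable_sort n f e) \<subseteq> S"
proof -
  define e' where "e' = stable_sort n f e"
  have e': "e' permutes {1..n}" "is_stable_sort n f e e'"
    unfolding e'_def using e by (fact stable_sort_permutes is_stable_sort_stable_sort)+
  obtain g where g: "g permutes {1..n}" "f = label S \<circ> inv g" using f by (auto simp: words_def)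
  have "f (e' p) \<le> f (e' q)" if "p \<in> {1..n}" "q \<in> {1..n}" "p \<le> q" for p q
  proof (cases "p = q")
    case False
    hence "p < q" using that(3) by simp
    thus ?thesis using e'(2) that(1,2) unfolding is_stable_sort_def by (metis less_imp_le order_refl)
  qed simp
  hence "mono_on {1..n} (f \<circ> e')" by (intro mono_onI) (simp only: comp_apply)
  hence "mono_on {1..n} (label S \<circ> (inv g \<circ> e'))" by (simp add: g(2) comp_assoc)
  moreover have "mono_on {1..n} (label S)" by (simp add: mono_onI label_mono[OF S])
  ultimately have "label S \<circ> (inv g \<circ> e') = label S"
    using mono_on_compose_permutes_eq permutes_compose[OF e'(1) permutes_inv[OF g(1)]] by blast
  hence fe': "f \<circ> e' = label S" by (simp add: g(2) comp_assoc)
  have "f \<circ> (e' \<circ> inv e') = label S \<circ> inv e'" by (simp only: fe' flip: comp_assoc)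
  hence "f = label S \<circ> inv e'" by (simp only: permutes_inv_o[OF e'(1)] comp_id)
  thus "f = label S \<circ> inv (stable_sort n f e)" unfolding e'_def .
  have "(inv e \<circ> e') p < (inv e \<circ> e') q"
    if "p \<in> {1..n}" "q \<in> {1..n}" "p < q" "label S p = label S q" for p q
    using e'(2) that fun_cong[OF fe', of p] fun_cong[OF fe', of q]
    unfolding is_stable_sort_def comp_apply by (metis less_irrefl)
  thus "Des n (inv e \<circ> stable_sort n f e) \<subseteq> S"
    unfolding Des_subset_iff[OF S permutes_compose[OF e'(1) permutes_inv[OF e]], unfolded e'_def]
      e'_def by blast
qed

text \<open>Right multiplication of \<open>e\<close> becomes sorting by words. The word attached to
  \<open>\<sigma>\<close> depends on \<open>e\<close>, but the set of words does not.\<close>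

lemma bij_betw_Des_subset_words:
  assumes S: "finite S" and e: "e permutes {1..n}"
  shows "bij_betw (\<lambda>\<sigma>. label S \<circ> inv (e \<circ> \<sigma>)) {\<sigma> \<in> Sym n. Des n \<sigma> \<subseteq> S} (words n S)"
proof (rule bij_betwI[of _ _ _ "\<lambda>f. inv e \<circ> stable_sort n f e"])
  have e1: "e \<circ> (inv e \<circ> h) = h" "inv e \<circ> (e \<circ> h) = h" for h :: "nat \<Rightarrow> nat"
    by (simp_all only: permutes_inv_o[OF e] id_comp flip: comp_assoc)
  show "(\<lambda>\<sigma>. label S \<circ> inv (e \<circ> \<sigma>)) \<in> {\<sigma> \<in> Sym n. Des n \<sigma> \<subseteq> S} \<rightarrow> words n S"
    using permutes_compose[OF _ e] by (auto simp: words_def)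
  show "(\<lambda>f. inv e \<circ> stable_sort n f e) \<in> words n S \<rightarrow> {\<sigma> \<in> Sym n. Des n \<sigma> \<subseteq> S}"
    using permutes_compose[OF stable_sort_permutes[OF e] permutes_inv[OF e]]
      stable_sort_word(2)[OF S e] by blast
  show "inv e \<circ> stable_sort n (label S \<circ> inv (e \<circ> \<sigma>)) e = \<sigma>"
    if "\<sigma> \<in> {\<sigma> \<in> Sym n. Des n \<sigma> \<subseteq> S}" for \<sigma>
    using that by (simp only: mem_Collect_eq stable_sort_label[OF S e] e1)
  show "label S \<circ> inv (e \<circ> (inv e \<circ> stable_sort n f e)) = f" if "f \<in> words n S" for f
    unfolding e1 using stable_sort_word(1)[OF S e that] by (rule sym)
qed

section \<open>Products in the group ring and their symmetry\<close>

text \<open>This is the coefficient of \<open>t\<close> in the product of \<open>e\<close> and the group ring elements with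
  coefficient functions \<open>as\<close>.\<close>

fun walks :: "nat \<Rightarrow> ((nat \<Rightarrow> nat) \<Rightarrow> int) list \<Rightarrow> (nat \<Rightarrow> nat) \<Rightarrow> (nat \<Rightarrow> nat) \<Rightarrow> int" where
  "walks n [] e t = of_bool (e = t)"
| "walks n (a # as) e t = (\<Sum>\<sigma>\<in>Sym n. a \<sigma> * walks n as (e \<circ> \<sigma>) t)"

lemma walks_Des_subset:
  assumes S: "finite S" and e: "e permutes {1..n}"
  shows "walks n ((\<lambda>\<sigma>. of_bool (Des n \<sigma> \<subseteq> S)) # as) e t =
    (\<Sum>f\<in>words n S. walks n as (stable_sort n f e) t)"
proof -
  have "walks n ((\<lambda>\<sigma>. of_bool (Des n \<sigma> \<subseteq> S)) # as) e t =
      (\<Sum>\<sigma>\<in>{\<sigma> \<in> Sym n. Des n \<sigma> \<subseteq> S}. walks n as (e \<circ> \<sigma>) t)"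
    unfolding walks.simps by (rule sum.mono_neutral_cong_right[OF finite_Sym]) auto
  also have "\<dots> = (\<Sum>\<sigma>\<in>{\<sigma> \<in> Sym n. Des n \<sigma> \<subseteq> S}.
      walks n as (stable_sort n (label S \<circ> inv (e \<circ> \<sigma>)) e) t)"
    by (rule sum.cong) (simp_all only: mem_Collect_eq stable_sort_label[OF S e])
  also have "\<dots> = (\<Sum>f\<in>words n S. walks n as (stable_sort n f e) t)"
    by (rule sum.reindex_bij_betw[OF bij_betw_Des_subset_words[OF S e]])
  finally show ?thesis .
qed

text \<open>Moebius inversion on subsets: \<open>X \<subseteq> S\<close> holds iff
  \<open>X = T\<close> for exactly one \<open>T \<subseteq> S\<close>.\<close>

lemma of_bool_eq_sum_subsets:
  assumes "finite D"
  shows "(of_bool (X = D) :: int) = (\<Sum>S\<in>Pow D. (-1) ^ (card D - card S) * of_bool (X \<subseteq> S))"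
  using inclusion_exclusion_mobius[of "\<lambda>S. of_bool (X \<subseteq> S)" "\<lambda>S. of_bool (X = S)" D] assms
  by (simp add: of_bool_def)

text \<open>The inner sum is the permutation character on words; for
  \<open>D \<subseteq> {1..n - 1}\<close> the signed sum is the ribbon character of
  \<open>D\<close>.\<close>

definition fixed_words :: "nat \<Rightarrow> nat set \<Rightarrow> (nat \<Rightarrow> nat) \<Rightarrow> int" where
  "fixed_words n D g =
    (\<Sum>S\<in>Pow D. (-1) ^ (card D - card S) * (\<Sum>f\<in>words n S. of_bool (f \<circ> g = f)))"

lemma walks_Des:
  assumes D: "finite D" and e: "e permutes {1..n}"
  shows "walks n ((\<lambda>\<sigma>. of_bool (Des n \<sigma> = D)) # as) e t =
    (\<Sum>S\<in>Pow D. (-1) ^ (card D - card S) * (\<Sum>f\<in>words n S. walks n as (stable_sort n f e) t))"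
proof -
  have "walks n ((\<lambda>\<sigma>. of_bool (Des n \<sigma> = D)) # as) e t =
      (\<Sum>S\<in>Pow D. (-1) ^ (card D - card S) * walks n ((\<lambda>\<sigma>. of_bool (Des n \<sigma> \<subseteq> S)) # as) e t)"
    unfolding walks.simps of_bool_eq_sum_subsets[OF D] sum_distrib_right sum_distrib_left mult.assoc
    by (rule sum.swap)
  also have "\<dots> = (\<Sum>S\<in>Pow D. (-1) ^ (card D - card S) *
      (\<Sum>f\<in>words n S. walks n as (stable_sort n f e) t))"
    by (intro sum.cong refl arg_cong2[where f = "(*)"] walks_Des_subset e)
      (use D finite_subset in auto)
  finally show ?thesis .
qed

text \<open>The key \<open>x\<close> records the sorts already performed; the induction on
  \<open>Ds\<close> replaces it by \<open>f a * M + x a\<close>, which is why \<open>x\<close> and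
  its bound \<open>M\<close> are general. At the end, sorted arrangements are traded for stabilisers
  of the accumulated key.\<close>

lemma sum_walks_Des:
  assumes "\<forall>D\<in>set Ds. finite D" and "\<And>a. x a < M"
  shows "(\<Sum>e\<in>Sym n. walks n (map (\<lambda>D \<sigma>. of_bool (Des n \<sigma> = D)) Ds) (stable_sort n x e) e) =
    (\<Sum>g\<in>Sym n. of_bool (x \<circ> g = x) * (\<Prod>D\<leftarrow>Ds. fixed_words n D g))"
  using assms
proof (induction Ds arbitrary: x M)
  case Nil
  have "(\<Sum>e\<in>Sym n. (of_bool (stable_sort n x e = e) :: int)) =
      (\<Sum>e\<in>Sym n. of_bool (mono_on {1..n} (x \<circ> e)))"
    by (rule sum.cong) (simp_all only: mem_Collect_eq stable_sort_fixed_iff)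
  also have "\<dots> = (\<Sum>g\<in>Sym n. of_bool (x \<circ> g = x))"
    using card_mono_on_compose[of n x] finite_Sym[of n] by (simp add: sum_of_bool_eq Collect_conj_eq)
  finally show ?case unfolding list.map walks.simps prod_list.Nil mult_1_right .
next
  case (Cons D Ds)
  define L where "L = map (\<lambda>D \<sigma>. of_bool (Des n \<sigma> = D) :: int) Ds"
  define P where "P g = (\<Prod>D\<leftarrow>Ds. fixed_words n D g)" for g
  have D: "finite D" using Cons.prems by simp
  have "(\<Sum>e\<in>Sym n. walks n (map (\<lambda>D \<sigma>. of_bool (Des n \<sigma> = D)) (D # Ds)) (stable_sort n x e) e) =
      (\<Sum>e\<in>Sym n. \<Sum>S\<in>Pow D. \<Sum>f\<in>words n S. (-1) ^ (card D - card S) *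
        walks n L (stable_sort n (\<lambda>a. f a * M + x a) e) e)"
    unfolding list.map L_def[symmetric]
    by (rule sum.cong) (simp_all only: mem_Collect_eq walks_Des[OF D stable_sort_permutes]
      stable_sort_stable_sort[OF _ Cons.prems(2)] sum_distrib_left)
  also have "\<dots> = (\<Sum>S\<in>Pow D. \<Sum>f\<in>words n S. (-1) ^ (card D - card S) *
      (\<Sum>e\<in>Sym n. walks n L (stable_sort n (\<lambda>a. f a * M + x a) e) e))"
    unfolding sum_distrib_left by (subst sum.swap, rule sum.cong[OF refl], rule sum.swap)
  also have "\<dots> = (\<Sum>S\<in>Pow D. \<Sum>f\<in>words n S. (-1) ^ (card D - card S) *
      (\<Sum>g\<in>Sym n. of_bool (f \<circ> g = f) * (of_bool (x \<circ> g = x) * P g)))"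
  proof (rule sum.cong[OF refl], rule sum.cong[OF refl], rule arg_cong2[OF refl, of _ _ "(*)"])
    fix S f assume Sf: "S \<in> Pow D" "f \<in> words n S"
    define y where "y = (\<lambda>a. f a * M + x a)"
    have "finite S" using Sf(1) D finite_subset by blast
    hence fb: "f a \<le> card S" for a using words_bounded[OF _ Sf(2), of a] by simp
    \<comment> \<open>The bound for the new key, required by the induction hypothesis.\<close>
    have y: "y a < Suc (card S) * M" for a
    proof -
      have "y a < Suc (f a) * M" using Cons.prems(2)[of a] by (simp add: y_def)
      also have "\<dots> \<le> Suc (card S) * M" using fb[of a] by (intro mult_le_mono1) simp
      finally show ?thesis .
    qed
    \<comment> \<open>The combined key determines both digits, so \<open>g\<close> fixes
      \<open>y\<close> iff it fixes \<open>f\<close> and \<open>x\<close>; the factor for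
      \<open>f\<close> splits off.\<close>
    have "y a = y b \<longleftrightarrow> f a = f b \<and> x a = x b" for a b
      using less_mult_add_iff[OF Cons.prems(2) Cons.prems(2), of "f a" a "f b" b]
        less_mult_add_iff[OF Cons.prems(2) Cons.prems(2), of "f b" b "f a" a]
      unfolding y_def by (metis less_irrefl linorder_neqE_nat)
    hence yg: "y \<circ> g = y \<longleftrightarrow> f \<circ> g = f \<and> x \<circ> g = x" for g
      unfolding fun_eq_iff comp_apply by blast
    have "(\<Sum>e\<in>Sym n. walks n L (stable_sort n y e) e) =
        (\<Sum>g\<in>Sym n. of_bool (y \<circ> g = y) * P g)"
      unfolding L_def P_def using Cons.prems(1) y by (intro Cons.IH) auto
    thus "(\<Sum>e\<in>Sym n. walks n L (stable_sort n (\<lambda>a. f a * M + x a) e) e) =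
        (\<Sum>g\<in>Sym n. of_bool (f \<circ> g = f) * (of_bool (x \<circ> g = x) * P g))"
      unfolding y_def[symmetric] by (simp only: yg of_bool_conj mult.assoc)
  qed
  also have "\<dots> = (\<Sum>g\<in>Sym n. \<Sum>S\<in>Pow D. \<Sum>f\<in>words n S. (-1) ^ (card D - card S) *
      (of_bool (f \<circ> g = f) * (of_bool (x \<circ> g = x) * P g)))"
    unfolding sum_distrib_left
    by (rule sym, subst sum.swap, rule sum.cong[OF refl], rule sum.swap)
  also have "\<dots> = (\<Sum>g\<in>Sym n. of_bool (x \<circ> g = x) * (\<Prod>D\<leftarrow>D # Ds. fixed_words n D g))"
    unfolding list.map prod_list.Cons P_def[symmetric] unfolding fixed_words_def
    by (rule sum.cong) (simp_all add: sum_distrib_left sum_distrib_right mult_ac)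
  finally show ?case .
qed

lemma walks_left_invariant:
  assumes "inj g"
  shows "walks n as (g \<circ> e) (g \<circ> t) = walks n as e t"
proof (induction as arbitrary: e)
  case Nil
  show ?case using assms by (simp add: inj_eq fun_eq_iff)
next
  case (Cons a as)
  show ?case unfolding walks.simps comp_assoc Cons.IH ..
qed

lemma walks_Des_eq_sum:
  assumes "\<forall>D\<in>set Ds. finite D"
  shows "fact n * walks n (map (\<lambda>D \<sigma>. of_bool (Des n \<sigma> = D)) Ds) id id =
    (\<Sum>g\<in>Sym n. \<Prod>D\<leftarrow>Ds. fixed_words n D g)"
proof -
  define L where "L = map (\<lambda>D \<sigma>. of_bool (Des n \<sigma> = D) :: int) Ds"
  \<comment> \<open>The constant key 0, with bound 1, is fixed by every \<open>g\<close> and sorting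
    by it changes nothing. Left invariance then makes all closed walks equivalent to those at
    \<open>id\<close>.\<close>
  have "(\<Sum>g\<in>Sym n. \<Prod>D\<leftarrow>Ds. fixed_words n D g) =
      (\<Sum>e\<in>Sym n. walks n L (stable_sort n (\<lambda>_. 0) e) e)"
    unfolding L_def by (subst sum_walks_Des[OF assms, of _ 1]) (simp_all add: comp_def)
  also have "\<dots> = (\<Sum>e\<in>Sym n. walks n L id id)"
  proof (rule sum.cong[OF refl])
    fix e assume "e \<in> Sym n"
    hence e: "e permutes {1..n}" by simp
    have "mono_on {1..n} ((\<lambda>_. 0::nat) \<circ> e)" by (simp add: mono_onI)
    hence "stable_sort n (\<lambda>_. 0) e = e" using stable_sort_fixed_iff[OF e] by blast
    thus "walks n L (stable_sort n (\<lambda>_. 0) e) e = walks n L id id"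
      using walks_left_invariant[OF permutes_inj[OF e], of n L id id] by simp
  qed
  also have "\<dots> = fact n * walks n L id id"
    using card_permutations[of "{1..n}" n] by simp
  finally show ?thesis by (simp add: L_def)
qed

text \<open>For each \<open>g\<close> the sum in \<open>walks_Des_eq_sum\<close> has a product of
  integers, which ignores the order of the factors; \<open>fact n\<close> cancels.\<close>

lemma walks_Des_cong_mset:
  assumes "\<forall>D\<in>set Ds. finite D" "mset Ds = mset Es"
  shows "walks n (map (\<lambda>D \<sigma>. of_bool (Des n \<sigma> = D)) Ds) id id =
    walks n (map (\<lambda>D \<sigma>. of_bool (Des n \<sigma> = D)) Es) id id"
proof -
  have "(\<Prod>D\<leftarrow>Ds. fixed_words n D g) = (\<Prod>D\<leftarrow>Es. fixed_words n D g)" for g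
    using assms(2) by (metis mset_map prod_mset_prod_list)
  hence "fact n * walks n (map (\<lambda>D \<sigma>. of_bool (Des n \<sigma> = D)) Ds) id id =
      fact n * walks n (map (\<lambda>D \<sigma>. of_bool (Des n \<sigma> = D)) Es) id id"
    using assms mset_eq_setD[OF assms(2)] by (simp add: walks_Des_eq_sum)
  thus ?thesis by simp
qed

section \<open>The longest element and its effect on descents\<close>

definition longest :: "nat \<Rightarrow> nat \<Rightarrow> nat" where
  "longest n i = (if i \<in> {1..n} then n + 1 - i else i)"

lemma longest_longest: "longest n \<circ> longest n = id"
  by (auto simp: longest_def fun_eq_iff)

lemma longest_permutes: "longest n permutes {1..n}"
proof (rule bij_imp_permutes)
  show "bij_betw (longest n) {1..n} {1..n}"
    by (rule bij_betwI[of _ _ _ "longest n"]) (auto simp: longest_def)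
qed (auto simp: longest_def)

text \<open>Reversing positions turns the pair \<open>i\<close>, \<open>i + 1\<close> into
  \<open>n - i + 1\<close>, \<open>n - i\<close>.\<close>

lemma Des_compose_longest:
  assumes "\<sigma> permutes {1..n}"
  shows "Des n (\<sigma> \<circ> longest n) = Coasc n \<sigma>"
proof (rule set_eqI)
  fix i
  show "i \<in> Des n (\<sigma> \<circ> longest n) \<longleftrightarrow> i \<in> Coasc n \<sigma>"
  proof (cases "i \<in> {1..n - 1}")
    case True
    hence "longest n i = n - i + 1" "longest n (i + 1) = n - i" "n - i \<in> {1..n - 1}"
      by (auto simp: longest_def)
    moreover have "\<sigma> (n - i) \<noteq> \<sigma> (n - i + 1)"
      using permutes_inj[OF assms] by (simp add: inj_eq)
    ultimately show ?thesis using True by (auto simp: Des_def Coasc_def Asc_def)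
  qed (auto simp: Des_def Coasc_def)
qed

lemma Des_longest_compose:
  assumes "\<sigma> permutes {1..n}"
  shows "Des n (longest n \<circ> \<sigma>) = Asc n \<sigma>"
proof (rule set_eqI)
  fix i
  show "i \<in> Des n (longest n \<circ> \<sigma>) \<longleftrightarrow> i \<in> Asc n \<sigma>"
  proof (cases "i \<in> {1..n - 1}")
    case True
    hence "i \<in> {1..n}" "i + 1 \<in> {1..n}" by auto
    hence "\<sigma> i \<in> {1..n}" "\<sigma> (i + 1) \<in> {1..n}" by (simp_all only: permutes_in_image[OF assms])
    moreover have "\<sigma> i \<noteq> \<sigma> (i + 1)"
      using permutes_inj[OF assms] by (simp add: inj_eq)
    ultimately show ?thesis using True by (auto simp: Des_def Asc_def longest_def)
  qed (auto simp: Des_def Asc_def)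
qed

lemma Des_longest_conjugate:
  assumes "\<sigma> permutes {1..n}"
  shows "Des n (longest n \<circ> \<sigma> \<circ> longest n) = Codes n \<sigma>"
proof -
  have "Des n (longest n \<circ> \<sigma> \<circ> longest n) = Coasc n (longest n \<circ> \<sigma>)"
    by (rule Des_compose_longest[OF permutes_compose[OF assms longest_permutes]])
  also have "\<dots> = Codes n \<sigma>"
  proof (rule set_eqI)
    fix i
    show "i \<in> Coasc n (longest n \<circ> \<sigma>) \<longleftrightarrow> i \<in> Codes n \<sigma>"
    proof (cases "i \<in> {1..n - 1}")
      case True
      hence "n - i \<in> {1..n - 1}" by auto
      thus ?thesis
        using True unfolding Coasc_def Codes_def Asc_def[of n "longest n \<circ> \<sigma>"]
          Des_longest_compose[OF assms] by (simp add: Asc_def)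
    qed (auto simp: Coasc_def Codes_def)
  qed
  finally show ?thesis .
qed

text \<open>This makes the longest element itself a sum over a descent class, so it can be moved
  among the other factors.\<close>

lemma Des_eq_full_iff:
  assumes "\<tau> permutes {1..n}"
  shows "Des n \<tau> = {1..n - 1} \<longleftrightarrow> \<tau> = longest n"
proof
  assume full: "Des n \<tau> = {1..n - 1}"
  have p: "longest n \<circ> \<tau> permutes {1..n}" by (rule permutes_compose[OF assms longest_permutes])
  \<comment> \<open>For the empty set of cut points all labels agree, so having no descents means
    strict increase on \<open>{1..n}\<close>.\<close>
  have "Des n (longest n \<circ> \<tau>) \<subseteq> {}"
    unfolding Des_longest_compose[OF assms] by (simp add: Asc_def full)
  hence "strict_mono_on {1..n} (longest n \<circ> \<tau>)"
    unfolding Des_subset_iff[OF finite.emptyI p] by (intro strict_mono_onI) (simp add: label_def)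
  hence "longest n \<circ> \<tau> = id"
    using strict_mono_on_permutes_eq[of n id "longest n \<circ> \<tau>" id] p
    by (simp add: permutes_id strict_mono_on_def)
  hence "longest n \<circ> (longest n \<circ> \<tau>) = longest n" by simp
  thus "\<tau> = longest n" by (simp only: longest_longest id_comp flip: comp_assoc)
next
  assume "\<tau> = longest n"
  hence "Des n \<tau> = Coasc n id"
    using Des_compose_longest[of id n] permutes_id by simp
  also have "\<dots> = {1..n - 1}"
    by (auto simp: Coasc_def Asc_def Des_def)
  finally show "Des n \<tau> = {1..n - 1}" .
qed

section \<open>Twists by the longest element\<close>

abbreviation weight :: "nat \<Rightarrow> nat set \<Rightarrow> (nat \<Rightarrow> nat) \<Rightarrow> int" where
  "weight n D \<equiv> (\<lambda>\<sigma>. of_bool (Des n \<sigma> = D))"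

definition twist :: "nat \<Rightarrow> bool \<Rightarrow> nat \<Rightarrow> nat" where
  "twist n b = (if b then longest n else id)"

lemma twist_permutes: "twist n b permutes {1..n}"
  by (simp add: twist_def longest_permutes permutes_id del: One_nat_def)

lemma twist_twist: "twist n b \<circ> twist n b = id"
  by (simp add: twist_def longest_longest)

lemma walks_full: "walks n (weight n {1..n - 1} # as) e t = walks n as (e \<circ> longest n) t"
proof -
  have "walks n (weight n {1..n - 1} # as) e t =
      (\<Sum>\<sigma>\<in>{longest n}. weight n {1..n - 1} \<sigma> * walks n as (e \<circ> \<sigma>) t)"
    unfolding walks.simps
  proof (rule sum.mono_neutral_right[OF finite_Sym])
    show "{longest n} \<subseteq> Sym n" using longest_permutes by blast
    show "\<forall>\<sigma>\<in>Sym n - {longest n}. weight n {1..n - 1} \<sigma> * walks n as (e \<circ> \<sigma>) t = 0"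
      using Des_eq_full_iff by auto
  qed
  moreover have "Des n (longest n) = {1..n - 1}" using Des_eq_full_iff[OF longest_permutes] by blast
  ultimately show ?thesis by (simp add: comp_def)
qed

text \<open>Each full descent set multiplies the start by the longest element, and pairs of these
  cancel.\<close>

lemma walks_replicate_full:
  "walks n (map (weight n) (replicate m {1..n - 1} @ Ds)) e t =
    walks n (map (weight n) Ds) (e \<circ> twist n (odd m)) t"
proof (induction m arbitrary: e)
  case (Suc m)
  have "longest n \<circ> twist n (odd m) = twist n (odd (Suc m))"
    by (simp add: twist_def longest_longest)
  thus ?case
    using Suc by (simp only: replicate_Suc append_Cons list.map walks_full comp_assoc)
qed (simp add: twist_def)

definition twist_list :: "nat \<Rightarrow> bool \<Rightarrow> nat set \<Rightarrow> bool \<Rightarrow> nat set list" where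
  "twist_list n l D r =
    replicate (of_bool l) {1..n - 1} @ [D] @ replicate (of_bool r) {1..n - 1}"

text \<open>The substitution \<open>\<sigma> = twist n l \<circ> \<tau> \<circ> twist n r\<close>
  permutes \<open>Sym n\<close> and is its own inverse, so a twisted descent condition costs at most
  two extra full factors.\<close>

lemma walks_twist_list:
  "walks n (map (weight n) (twist_list n l D r @ Ds)) e t =
    walks n ((\<lambda>\<sigma>. of_bool (Des n (twist n l \<circ> \<sigma> \<circ> twist n r) = D)) # map (weight n) Ds) e t"
proof -
  have odd_iff: "odd (of_bool b :: nat) \<longleftrightarrow> b" for b by simp
  define h where "h \<sigma> = of_bool (Des n (twist n l \<circ> \<sigma> \<circ> twist n r) = D) *
    walks n (map (weight n) Ds) (e \<circ> \<sigma>) t" for \<sigma>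
  have "walks n (map (weight n) (twist_list n l D r @ Ds)) e t =
      (\<Sum>\<tau>\<in>Sym n. weight n D \<tau> * walks n (map (weight n) Ds) (e \<circ> (twist n l \<circ> (\<tau> \<circ> twist n r))) t)"
    unfolding twist_list_def append_assoc walks_replicate_full odd_iff append_Cons append_Nil
      list.map walks.simps comp_assoc ..
  also have "\<dots> = (\<Sum>\<tau>\<in>Sym n. h (twist n l \<circ> (\<tau> \<circ> twist n r)))"
  proof (rule sum.cong[OF refl])
    fix \<tau>
    have "twist n l \<circ> (twist n l \<circ> (\<tau> \<circ> twist n r)) \<circ> twist n r =
        (twist n l \<circ> twist n l) \<circ> \<tau> \<circ> (twist n r \<circ> twist n r)"
      by (simp only: comp_assoc)
    thus "weight n D \<tau> * walks n (map (weight n) Ds) (e \<circ> (twist n l \<circ> (\<tau> \<circ> twist n r))) t =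
        h (twist n l \<circ> (\<tau> \<circ> twist n r))"
      unfolding h_def twist_twist by simp
  qed
  also have "\<dots> = (\<Sum>\<sigma>\<in>Sym n. h \<sigma>)"
    unfolding setum_permutations_compose_left[OF twist_permutes, of h n l]
    by (rule sum_permutations_compose_right[OF twist_permutes, symmetric])
  finally show ?thesis unfolding walks.simps h_def .
qed

lemma walks_map_cong:
  assumes "\<And>p \<sigma>. p \<in> set ps \<Longrightarrow> \<sigma> permutes {1..n} \<Longrightarrow> a p \<sigma> = b p \<sigma>"
  shows "walks n (map a ps) e t = walks n (map b ps) e t"
  using assms
proof (induction ps arbitrary: e)
  case (Cons p ps)
  have "walks n (map a ps) (e \<circ> \<sigma>) t = walks n (map b ps) (e \<circ> \<sigma>) t" for \<sigma>
    using Cons by (meson list.set_intros(2))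
  thus ?case
    unfolding list.map walks.simps using Cons.prems by (intro sum.cong refl) simp
qed simp

lemma walks_concat_twist_list:
  "walks n (map (\<lambda>p \<sigma>. of_bool (Des n (twist n (l p) \<circ> \<sigma> \<circ> twist n (r p)) = D p)) ps) e t =
    walks n (map (weight n) (concat (map (\<lambda>p. twist_list n (l p) (D p) (r p)) ps))) e t"
proof (induction ps arbitrary: e)
  case (Cons p ps)
  show ?case
    unfolding list.map concat.simps walks_twist_list unfolding walks.simps Cons.IH ..
qed simp

section \<open>From tuples to walks\<close>

text \<open>A tuple splits into its entry at the first index and the rest; the start
  \<open>e\<close> is general because it absorbs that entry.\<close>

lemma card_PiE_foldr_eq_walks:
  assumes "distinct ps" and "\<And>p. p \<in> set ps \<Longrightarrow> A p \<subseteq> Sym n"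
  shows "int (card {\<sigma> \<in> PiE (set ps) A. e \<circ> foldr (\<circ>) (map \<sigma> ps) id = t}) =
    walks n (map (\<lambda>p \<sigma>. of_bool (\<sigma> \<in> A p)) ps) e t"
  using assms
proof (induction ps arbitrary: e)
  case Nil
  show ?case by (auto simp: of_bool_def)
next
  case (Cons p ps)
  define B where "B y = {g \<in> PiE (set ps) A. (e \<circ> y) \<circ> foldr (\<circ>) (map g ps) id = t}" for y
  have fA: "finite (A q)" if "q \<in> set (p # ps)" for q
    using Cons.prems(2)[OF that] finite_Sym finite_subset by blast
  have fB: "finite (B y)" for y
    unfolding B_def using fA by (simp add: finite_PiE)
  have upd: "map (g(p := y)) ps = map g ps" for g :: "'a \<Rightarrow> nat \<Rightarrow> nat" and y
    using Cons.prems(1) by (simp add: map_fun_upd)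
  define F :: "(nat \<Rightarrow> nat) \<times> ('a \<Rightarrow> nat \<Rightarrow> nat) \<Rightarrow> 'a \<Rightarrow> nat \<Rightarrow> nat"
    where "F = (\<lambda>(y, g). g(p := y))"
  have "(SIGMA y:A p. B y) =
      {z \<in> A p \<times> PiE (set ps) A. e \<circ> foldr (\<circ>) (map (F z) (p # ps)) id = t}"
    by (auto simp: B_def F_def upd comp_assoc)
  hence "{\<sigma> \<in> PiE (set (p # ps)) A. e \<circ> foldr (\<circ>) (map \<sigma> (p # ps)) id = t} =
      F ` (SIGMA y:A p. B y)"
    unfolding list.set PiE_insert_eq F_def[symmetric] by blast
  moreover have "inj_on F (SIGMA y:A p. B y)"
    unfolding F_def
    by (rule inj_on_subset[OF inj_combinator[of p "set ps" A]]) (use Cons.prems in \<open>auto simp: B_def\<close>)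
  ultimately have "card {\<sigma> \<in> PiE (set (p # ps)) A. e \<circ> foldr (\<circ>) (map \<sigma> (p # ps)) id = t} =
      (\<Sum>y\<in>A p. card (B y))"
    using fA fB by (simp add: card_image)
  hence "int (card {\<sigma> \<in> PiE (set (p # ps)) A. e \<circ> foldr (\<circ>) (map \<sigma> (p # ps)) id = t}) =
      int (\<Sum>y\<in>A p. card (B y))" by (rule arg_cong)
  also have "\<dots> = (\<Sum>y\<in>A p. walks n (map (\<lambda>p \<sigma>. of_bool (\<sigma> \<in> A p)) ps) (e \<circ> y) t)"
    unfolding of_nat_sum B_def
    by (intro sum.cong refl Cons.IH) (use Cons.prems in auto)
  also have "\<dots> = walks n (map (\<lambda>p \<sigma>. of_bool (\<sigma> \<in> A p)) (p # ps)) e t"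
    unfolding list.map walks.simps
    by (rule sum.mono_neutral_cong_left[OF finite_Sym]) (use Cons.prems in auto)
  finally show ?case .
qed

text \<open>The right side no longer mentions \<open>i1\<close>, \<open>i3\<close> or
  \<open>\<pi>\<close>: all longest elements are gathered in front, where they cancel up to
  parity.\<close>

lemma C_count_eq_walks:
  assumes D: "\<And>i. i \<in> {1..k} \<Longrightarrow> finite (D i)"
    and i: "i1 \<le> i2" "i2 \<le> i3" "i3 \<le> k" and \<pi>: "\<pi> permutes {1..k}"
  shows "int (C_count n k D i1 i2 i3 \<pi>) =
    walks n (map (weight n) (map D [1..<k + 1])) (twist n (odd (k - i2))) id"
proof -
  \<comment> \<open>\<open>l\<close> marks reversal of values (\<open>Codes\<close>,
    \<open>Asc\<close>), \<open>r\<close> reversal of positions (\<open>Codes\<close>,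
    \<open>Coasc\<close>).\<close>
  define l where "l i \<longleftrightarrow> i1 < i \<and> i \<le> i3" for i
  define r where "r i \<longleftrightarrow> i1 < i \<and> i \<le> i2 \<or> i3 < i" for i
  define A where "A i = {\<tau> \<in> Sym n. Des n (twist n (l i) \<circ> \<tau> \<circ> twist n (r i)) = D i}" for i
  define m where "m = (\<Sum>i\<in>{1..k}. of_bool (l i) + of_bool (r i) :: nat)"
  define L where "L i = twist_list n (l i) (D i) (r i)" for i
  have cond: "\<tau> \<in> A i \<longleftrightarrow> D i = (if i \<le> i1 then Des n \<tau> else if i \<le> i2 then Codes n \<tau>
      else if i \<le> i3 then Asc n \<tau> else Coasc n \<tau>)" if "\<tau> \<in> Sym n" for \<tau> i
    using that i by (auto simp: A_def l_def r_def twist_def Des_compose_longest Des_longest_compose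
      Des_longest_conjugate simp del: One_nat_def)
  have "{\<sigma> \<in> W_tuples n k. \<forall>i\<in>{1..k}. D i = (if i \<le> i1 then Des n (\<sigma> (\<pi> i))
      else if i \<le> i2 then Codes n (\<sigma> (\<pi> i)) else if i \<le> i3 then Asc n (\<sigma> (\<pi> i))
      else Coasc n (\<sigma> (\<pi> i)))} =
    {\<sigma> \<in> PiE (set [1..<k + 1]) (\<lambda>p. A (inv \<pi> p)). id \<circ> foldr (\<circ>) (map \<sigma> [1..<k + 1]) id = id}"
    (is "?X = ?Y")
  proof -
    have "\<sigma> \<in> ?X \<longleftrightarrow> \<sigma> \<in> ?Y" for \<sigma>
    proof (cases "\<sigma> \<in> {1..k} \<rightarrow>\<^sub>E Sym n")
      case True
      have mem: "\<sigma> (\<pi> i) \<in> Sym n" if "i \<in> {1..k}" for i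
        using that by (intro PiE_mem[OF True]) (simp only: permutes_in_image[OF \<pi>])
      have "(\<forall>i\<in>{1..k}. D i = (if i \<le> i1 then Des n (\<sigma> (\<pi> i))
          else if i \<le> i2 then Codes n (\<sigma> (\<pi> i)) else if i \<le> i3 then Asc n (\<sigma> (\<pi> i))
          else Coasc n (\<sigma> (\<pi> i)))) \<longleftrightarrow> (\<forall>i\<in>{1..k}. \<sigma> (\<pi> i) \<in> A i)"
        by (rule ball_cong[OF refl]) (rule cond[OF mem, symmetric])
      also have "\<dots> \<longleftrightarrow> (\<forall>p\<in>\<pi> ` {1..k}. \<sigma> p \<in> A (inv \<pi> p))"
        by (simp only: ball_simps permutes_inverses[OF \<pi>])
      also have "\<dots> \<longleftrightarrow> \<sigma> \<in> PiE (set [1..<k + 1]) (\<lambda>p. A (inv \<pi> p))"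
        unfolding permutes_image[OF \<pi>] using True by (auto simp: PiE_iff atLeastLessThanSuc_atLeastAtMost simp del: upt_Suc)
      finally show ?thesis using True by (simp only: W_tuples_def mem_Collect_eq id_comp) blast
    next
      case False
      hence "\<sigma> \<notin> ?X" unfolding W_tuples_def by blast
      moreover have "\<sigma> \<notin> ?Y"
        using False by (auto simp: PiE_iff A_def atLeastLessThanSuc_atLeastAtMost simp del: upt_Suc)
      ultimately show ?thesis by blast
    qed
    thus ?thesis by blast
  qed
  hence "int (C_count n k D i1 i2 i3 \<pi>) =
      walks n (map (\<lambda>p \<sigma>. of_bool (\<sigma> \<in> A (inv \<pi> p))) [1..<k + 1]) id id"
    unfolding C_count_def by (simp only:) (rule card_PiE_foldr_eq_walks, auto simp: A_def)
  also have "\<dots> = walks n (map (\<lambda>p \<sigma>. of_bool (Des n (twist n (l (inv \<pi> p)) \<circ> \<sigma> \<circ>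
      twist n (r (inv \<pi> p))) = D (inv \<pi> p))) [1..<k + 1]) id id"
    by (rule walks_map_cong) (simp add: A_def)
  also have "\<dots> = walks n (map (weight n) (concat (map (\<lambda>p. L (inv \<pi> p)) [1..<k + 1]))) id id"
    unfolding L_def by (rule walks_concat_twist_list)
  \<comment> \<open>Reordering undoes \<open>\<pi>\<close> and brings the \<open>m\<close> full sets
    to the front at once.\<close>
  also have "\<dots> = walks n (map (weight n) (replicate m {1..n - 1} @ map D [1..<k + 1])) id id"
  proof (rule walks_Des_cong_mset)
    have "inv \<pi> p \<in> {1..k}" if "p \<in> {1..k}" for p
      using that by (simp only: permutes_in_image[OF permutes_inv[OF \<pi>]])
    thus "\<forall>E\<in>set (concat (map (\<lambda>p. L (inv \<pi> p)) [1..<k + 1])). finite E"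
      using D by (fastforce simp: L_def twist_list_def)
    have sum: "sum_list (map f [1..<k + 1]) = (\<Sum>i\<in>{1..k}. f i)" for f :: "nat \<Rightarrow> nat set multiset"
      by (simp add: sum_list_distinct_conv_sum_set atLeastLessThanSuc_atLeastAtMost del: upt_Suc)
    have "mset (concat (map (\<lambda>p. L (inv \<pi> p)) [1..<k + 1])) = (\<Sum>p\<in>{1..k}. mset (L (inv \<pi> p)))"
      unfolding sum[symmetric] mset_concat by (simp add: comp_def del: upt_Suc)
    also have "\<dots> = (\<Sum>i\<in>{1..k}. mset (L i))"
      using sum.permute[OF permutes_inv[OF \<pi>], of "\<lambda>i. mset (L i)"] by (simp add: comp_def)
    also have "\<dots> = (\<Sum>i\<in>{1..k}. replicate_mset (of_bool (l i) + of_bool (r i)) {1..n - 1}) +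
        (\<Sum>i\<in>{1..k}. {#D i#})"
      unfolding sum.distrib[symmetric]
      by (rule sum.cong) (simp_all add: L_def twist_list_def of_bool_def)
    also have "(\<Sum>i\<in>{1..k}. replicate_mset (of_bool (l i) + of_bool (r i)) {1..n - 1}) =
        replicate_mset m {1..n - 1}"
      by (simp add: multiset_eq_iff count_sum m_def)
    also have "(\<Sum>i\<in>{1..k}. {#D i#}) = mset (map D [1..<k + 1])"
      unfolding sum[symmetric] by (induction k) auto
    finally show "mset (concat (map (\<lambda>p. L (inv \<pi> p)) [1..<k + 1])) =
        mset (replicate m {1..n - 1} @ map D [1..<k + 1])" by simp
  qed
  also have "\<dots> = walks n (map (weight n) (map D [1..<k + 1])) (twist n (odd m)) id"
    unfolding walks_replicate_full by simp
  also have "odd m \<longleftrightarrow> odd (k - i2)"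
  proof -
    \<comment> \<open>\<open>Des\<close> contributes no longest element, \<open>Codes\<close> two,
      \<open>Asc\<close> and \<open>Coasc\<close> one each; the odd indices are those beyond
      \<open>i2\<close>.\<close>
    have "{i \<in> {1..k}. odd (of_bool (l i) + of_bool (r i) :: nat)} = {i2<..k}"
      using i by (auto simp: l_def r_def of_bool_def split: if_splits)
    thus ?thesis unfolding m_def by (simp add: even_sum_iff)
  qed
  finally show ?thesis .
qed

theorem theorem4p7:
  fixes n k :: nat and D :: "nat \<Rightarrow> nat set"
    and i1 i2 i3 j1 j2 j3 :: nat and \<pi> \<rho> :: "nat \<Rightarrow> nat"
  assumes "n \<ge> 1" and "k \<ge> 1"
    and "\<And>i. i \<in> {1..k} \<Longrightarrow> D i \<subseteq> {1..n - 1}"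
    and "i1 \<le> i2" and "i2 \<le> i3" and "i3 \<le> k" and "\<pi> permutes {1..k}"
    and "j1 \<le> j2" and "j2 \<le> j3" and "j3 \<le> k" and "\<rho> permutes {1..k}"
    and "even i2 \<longleftrightarrow> even j2"
  shows "C_count n k D i1 i2 i3 \<pi> = C_count n k D j1 j2 j3 \<rho>"
proof -
  have D: "finite (D i)" if "i \<in> {1..k}" for i
    using assms(3)[OF that] finite_subset by blast
  have "odd (k - i2) \<longleftrightarrow> odd (k - j2)"
    using assms by (simp add: even_diff_nat)
  hence "int (C_count n k D i1 i2 i3 \<pi>) = int (C_count n k D j1 j2 j3 \<rho>)"
    using C_count_eq_walks[OF D assms(4-7)] C_count_eq_walks[OF D assms(8-11)] by simp
  thus ?thesis by simp
qed

end
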